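(* Fix a positive integer $s$ and $\epsilon\in\{1,-1\}$, and let the positive integers $v$ and $m$ vary within fixed congruence classes modulo $s$ (always excluding $\epsilon=-1$, $vm^2\le4$). Then, for each $n\ge0$, the packet $E_n$ of the pattern continued fraction of $\xi=svm/2+\sqrt{s^2v(vm^2+4\epsilon)/4}$ has a length independent of $(v,m)$, and every term of $E_n$ is independent of $(v,m)$ except its initial term, which is linear (affine, with coefficients independent of $v,m$) in $m$ when $n$ is odd and in $vm$ when $n$ is even.
   Context: Let $\delta_\epsilon=0$ if $\epsilon=1$ and $\delta_\epsilon=1$ if $\epsilon=-1$. Let $v_n=v$ for even $n$ and $v_n=1$ for odd $n$; $a_0=0$, $a_1=1$, $a_{n+1}=v_nma_n+\epsilon a_{n-1}$. For $n\ge0$ let $s_n=\gcd(a_n,s)$, let $m_n$ be the unique integer with $0\le m_n<s/s_n$ and $m_n(a_n/s_n)\equiv-a_{n-1}\pmod{s/s_n}$ (so $m_0=0$), and $\hat\xi_n=(s_nv_nm-\epsilon m_n)/(s/s_n)$. Every rational has exactly two finite continued fraction expansions $[c_0,\dots,c_r]$ with $c_0\in\mathbb{Z}$, $c_1,\dots,c_r\ge1$, whose lengths differ by one. The packet $E_0$ is the expansion of $\hat\xi_0$ and the packet $E_n$ ($n\ge1$) is the expansion of $\hat\xi_n-\delta_\epsilon$, each chosen with an odd number of terms if $\epsilon=1$ and an even number if $\epsilon=-1$. The pattern continued fraction of $\xi$ is the infinite continued fraction whose terms are the concatenation $E_0,E_1,E_2,\dots$ (it converges to $\xi$). *)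

theory Defs
  imports Complex_Main "HOL-Number_Theory.Cong"
begin

definition delta :: "int \<Rightarrow> int" where
  "delta eps = (if eps = 1 then 0 else 1)"

definition v_seq :: "int \<Rightarrow> nat \<Rightarrow> int" where
  "v_seq v n = (if even n then v else 1)"

fun a_seq :: "int \<Rightarrow> int \<Rightarrow> int \<Rightarrow> nat \<Rightarrow> int" where
  "a_seq eps v m 0 = 0"
| "a_seq eps v m (Suc 0) = 1"
| "a_seq eps v m (Suc (Suc n)) =
     v_seq v (Suc n) * m * a_seq eps v m (Suc n) + eps * a_seq eps v m n"

definition s_seq :: "int \<Rightarrow> int \<Rightarrow> int \<Rightarrow> int \<Rightarrow> nat \<Rightarrow> int" where
  "s_seq s eps v m n = gcd (a_seq eps v m n) s"

text \<open>
  Both integer divisions are exact. For \<open>n = 0\<close> the modulus is \<open>1\<close>, so the value used for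
  the term with index \<open>-1\<close> (here, by truncated subtraction, that with index \<open>0\<close>) is irrelevant
  and the result is \<open>0\<close>.
\<close>

definition m_seq :: "int \<Rightarrow> int \<Rightarrow> int \<Rightarrow> int \<Rightarrow> nat \<Rightarrow> int" where
  "m_seq s eps v m n =
     (THE k. 0 \<le> k \<and> k < s div s_seq s eps v m n \<and>
        [k * (a_seq eps v m n div s_seq s eps v m n) = - a_seq eps v m (n - 1)]
          (mod (s div s_seq s eps v m n)))"

definition xi_hat :: "int \<Rightarrow> int \<Rightarrow> int \<Rightarrow> int \<Rightarrow> nat \<Rightarrow> rat" where
  "xi_hat s eps v m n =
     of_int (s_seq s eps v m n * v_seq v n * m - eps * m_seq s eps v m n)
       / of_int (s div s_seq s eps v m n)"

fun cf_value :: "int list \<Rightarrow> rat" where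
  "cf_value [] = 0"
| "cf_value [c] = of_int c"
| "cf_value (c # d # cs) = of_int c + 1 / cf_value (d # cs)"

definition cf_expansion :: "int list \<Rightarrow> rat \<Rightarrow> bool" where
  "cf_expansion cs x \<longleftrightarrow> cs \<noteq> [] \<and> (\<forall>c \<in> set (tl cs). c \<ge> 1) \<and> cf_value cs = x"

text \<open>
  The packet \<open>E\<^sub>n\<close> of the pattern continued fraction of
  \<open>svm/2 + sqrt (s\<^sup>2 v (v m\<^sup>2 + 4 eps) / 4)\<close>, whose terms are the concatenation of the packets
  for \<open>n = 0, 1, 2, \<dots>\<close>. Of the two expansions of a rational, exactly one has the prescribed
  parity of length.
\<close>

definition packet :: "int \<Rightarrow> int \<Rightarrow> int \<Rightarrow> int \<Rightarrow> nat \<Rightarrow> int list" where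
  "packet s eps v m n =
     (THE cs. cf_expansion cs (if n = 0 then xi_hat s eps v m 0
                               else xi_hat s eps v m n - of_int (delta eps))
        \<and> (if eps = 1 then odd (length cs) else even (length cs)))"

end

theory Submission imports Defs begin

text \<open>
  Modulo \<open>s\<close>, the numbers \<open>a\<^sub>n\<close> depend only on the classes of \<open>v\<close> and \<open>m\<close>, hence so do
  \<open>s\<^sub>n\<close>, the class of \<open>a\<^sub>n / s\<^sub>n\<close> modulo \<open>s / s\<^sub>n\<close>, and therefore \<open>m\<^sub>n\<close>. Changing \<open>(v, m)\<close>
  within its classes thus changes \<open>xi_hat\<close> by \<open>s\<^sub>n\<^sup>2 / s\<close> times the change of \<open>v\<^sub>n m\<close>, which is
  an integer. Adding an integer to a rational only shifts the initial term of its expansion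
  of given parity.
\<close>

section \<open>Finite continued fraction expansions\<close>

lemma cf_value_Cons: "cs \<noteq> [] \<Longrightarrow> cf_value (c # cs) = of_int c + 1 / cf_value cs"
  by (cases cs) auto

lemma cf_value_shift: "cf_value ((c + k) # cs) = cf_value (c # cs) + of_int k"
  by (cases cs) auto

lemma cf_value_ge_1:
  assumes "cs \<noteq> []" "\<forall>c\<in>set cs. c \<ge> 1"
  shows "cf_value cs \<ge> 1"
  using assms
proof (induction cs rule: cf_value.induct)
  case (3 c d cs)
  then have "cf_value (d # cs) \<ge> 1" "(of_int c :: rat) \<ge> 1" by auto
  moreover from this have "1 / cf_value (d # cs) \<ge> 0" by simp
  ultimately show ?case by (simp only: cf_value.simps)
qed auto

text \<open>A further term would add a positive reciprocal to a head that is already at least 1.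
  This isolates the one source of ambiguity in expansions: a final term \<open>c\<close> may be
  rewritten as \<open>c - 1, 1\<close>.\<close>

lemma cf_value_eq_1:
  assumes "cs \<noteq> []" "\<forall>c\<in>set cs. c \<ge> 1" "cf_value cs = 1"
  shows "cs = [1]"
proof (cases cs)
  case (Cons c ds)
  show ?thesis
  proof (cases "ds = []")
    case False
    then have "cf_value ds \<ge> 1" using assms Cons by (intro cf_value_ge_1) auto
    then have "1 / cf_value ds > 0" by simp
    moreover have "(of_int c :: rat) \<ge> 1" using assms Cons by auto
    moreover have "of_int c + 1 / cf_value ds = 1"
      using assms(3) cf_value_Cons[OF False, of c] Cons by simp
    ultimately show ?thesis by linarith
  qed (use assms Cons in auto)
qed (use assms in simp)

text \<open>Used to bound a head from below: a value above 1 forces the head to be positive.\<close>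

lemma cf_value_le_head:
  assumes "\<forall>c\<in>set cs. c \<ge> 1"
  shows "cf_value (c # cs) \<le> of_int c + 1"
proof (cases "cs = []")
  case False
  then have "cf_value cs \<ge> 1" using assms by (intro cf_value_ge_1)
  then show ?thesis using cf_value_Cons[OF False, of c] by simp
qed simp

text \<open>Strict bounds put both reciprocals in the open unit interval, so the integers are the
  floors of equal numbers.\<close>

lemma int_add_unit_fraction_unique:
  fixes y z :: rat
  assumes "of_int c + 1 / y = of_int d + 1 / z" "y > 1" "z > 1"
  shows "c = d" and "y = z"
proof -
  have "\<lfloor>of_int c + 1 / y\<rfloor> = c" "\<lfloor>of_int d + 1 / z\<rfloor> = d"
    using assms(2,3) by (auto simp: floor_unique)
  then show "c = d" using assms(1) by simp
  then show "y = z" using assms by simp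
qed

lemma int_add_unit_fraction_eq_int:
  fixes z :: rat
  assumes "of_int c = of_int d + 1 / z" "z \<ge> 1"
  shows "z = 1"
proof (rule ccontr)
  assume "z \<noteq> 1"
  then have "0 < 1 / z" "1 / z < 1" using assms(2) by auto
  then have "(0 :: rat) < of_int (c - d)" "of_int (c - d) < (1 :: rat)" using assms(1) by auto
  then show False by simp
qed

text \<open>Heads are compared first, then the tails by induction. The head is the floor of the
  value unless the tail has value 1, that is, unless the tail is \<open>[1]\<close>. If exactly one
  list has ended, the other tail must be \<open>[1]\<close>, which the parity assumption
  excludes.\<close>

lemma cf_value_inj:
  assumes "cf_value (c # cs) = cf_value (d # ds)"
    and "\<forall>x\<in>set cs. x \<ge> 1" "\<forall>x\<in>set ds. x \<ge> 1"
    and "even (length cs) = even (length ds)"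
  shows "c # cs = d # ds"
  using assms
proof (induction cs arbitrary: c d ds)
  case Nil
  show ?case
  proof (cases "ds = []")
    case False
    have eq: "of_int c = of_int d + 1 / cf_value ds"
      using Nil.prems(1) cf_value_Cons[OF False, of d] by simp
    have "cf_value ds = 1"
      by (rule int_add_unit_fraction_eq_int[OF eq cf_value_ge_1[OF False Nil.prems(3)]])
    then have "ds = [1]" by (rule cf_value_eq_1[OF False Nil.prems(3)])
    then show ?thesis using Nil.prems(4) by simp
  qed (use Nil in simp)
next
  case (Cons e es)
  let ?y = "cf_value (e # es)"
  have y: "?y \<ge> 1" using Cons.prems(2) by (intro cf_value_ge_1) auto
  show ?case
  proof (cases ds)
    case Nil
    then have eq: "of_int d = of_int c + 1 / ?y" using Cons.prems(1) by simp
    have "?y = 1" by (rule int_add_unit_fraction_eq_int[OF eq y])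
    then have "e # es = [1]" using Cons.prems(2) by (intro cf_value_eq_1) auto
    then show ?thesis using Nil Cons.prems(4) by simp
  next
    case ds: (Cons f fs)
    let ?z = "cf_value (f # fs)"
    have z: "?z \<ge> 1" using Cons.prems(3) ds by (intro cf_value_ge_1) auto
    have eq: "of_int c + 1 / ?y = of_int d + 1 / ?z" using Cons.prems(1) ds by simp
    have "c = d \<and> ?y = ?z"
    \<comment> \<open>A tail value of 1 makes both sides of \<open>eq\<close> integers, so the other
      tail value is 1 as well; otherwise both exceed 1 and the floor argument applies.\<close>
    proof (cases "?y = 1 \<or> ?z = 1")
      case True
      then have "?y = 1 \<and> ?z = 1"
      proof
        assume 1: "?y = 1"
        have "?z = 1"
          by (rule int_add_unit_fraction_eq_int[OF _ z, of "c + 1" d]) (use eq 1 in simp)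
        with 1 show ?thesis by simp
      next
        assume 1: "?z = 1"
        have "?y = 1"
          by (rule int_add_unit_fraction_eq_int[OF _ y, of "d + 1" c]) (use eq 1 in simp)
        with 1 show ?thesis by simp
      qed
      then show ?thesis using eq by simp
    next
      case False
      then have "?y > 1" "?z > 1" using y z by auto
      then show ?thesis using int_add_unit_fraction_unique[OF eq] by blast
    qed
    moreover from this have "e # es = f # fs"
      using Cons.IH[of e f fs] Cons.prems ds by simp
    ultimately show ?thesis using ds by simp
  qed
qed

lemma cf_expansion_unique:
  assumes "cf_expansion cs x" "cf_expansion ds x" "even (length cs) = even (length ds)"
  shows "cs = ds"
  using assms cf_value_inj[of "hd cs" "tl cs" "hd ds" "tl ds"]
  by (cases cs; cases ds) (auto simp: cf_expansion_def)

text \<open>Euclidean algorithm, as strong induction on the denominator with the parity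
  \<open>b\<close> left general, since each division step flips it.\<close>

lemma cf_expansion_exists_fraction:
  fixes p :: int and q :: nat
  assumes "q > 0"
  shows "\<exists>cs. cf_expansion cs (of_int p / of_nat q) \<and> (even (length cs) \<longleftrightarrow> b)"
  using assms
proof (induction q arbitrary: p b rule: less_induct)
  case (less q)
  define k where "k = p div int q"
  define r where "r = nat (p mod int q)"
  have r: "p = k * int q + int r" "r < q"
    using less.prems by (auto simp: k_def r_def nat_less_iff)
  have x: "(of_int p :: rat) / of_nat q = of_int k + of_nat r / of_nat q"
    using less.prems by (simp add: r(1) field_simps)
  show ?case
  proof (cases "r = 0")
    case True
    \<comment> \<open>The two expansions of an integer, one for each parity.\<close>
    let ?cs = "if b then [k - 1, 1] else [k]"
    have "cf_expansion ?cs (of_int p / of_nat q)" using x True by (simp add: cf_expansion_def)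
    moreover have "even (length ?cs) \<longleftrightarrow> b" by simp
    ultimately show ?thesis by blast
  next
    case False
    \<comment> \<open>The reciprocal of the fractional part has the smaller denominator
      \<open>r\<close>; prefixing \<open>k\<close> restores parity \<open>b\<close>.\<close>
    then obtain cs where cs: "cf_expansion cs (of_int (int q) / of_nat r)"
        "even (length cs) \<longleftrightarrow> \<not> b"
      using less.IH[of r "int q" "\<not> b"] r(2) by auto
    then obtain d ds where ds: "cs = d # ds" by (auto simp: cf_expansion_def neq_Nil_conv)
    have val: "cf_value (d # ds) = of_nat q / of_nat r" "\<forall>x\<in>set ds. x \<ge> 1"
      using cs(1) ds by (auto simp: cf_expansion_def)
    \<comment> \<open>The head \<open>d\<close> becomes a non-initial term after prefixing
      \<open>k\<close>, so it has to be at least 1.\<close>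
    have "(of_nat q :: rat) / of_nat r > 1" using False r(2) by simp
    then have "(of_int d :: rat) > 0" using cf_value_le_head[OF val(2), of d] val(1) by simp
    then have "d \<ge> 1" by simp
    then have "cf_expansion (k # cs) (of_int p / of_nat q)"
      using val x ds by (simp add: cf_expansion_def)
    moreover have "even (length (k # cs)) \<longleftrightarrow> b" using cs(2) by simp
    ultimately show ?thesis by blast
  qed
qed

lemma cf_expansion_exists: "\<exists>cs. cf_expansion cs x \<and> (even (length cs) \<longleftrightarrow> b)"
proof (cases x)
  case (Fract p q)
  then show ?thesis
    using cf_expansion_exists_fraction[of "nat q" p b] by (simp add: Fract_of_int_quotient)
qed

lemma cf_expansion_shift:
  assumes "cf_expansion cs x"
  shows "cf_expansion ((hd cs + k) # tl cs) (x + of_int k)"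
  using assms by (cases cs) (auto simp: cf_expansion_def cf_value_shift)

section \<open>Dependence on the residue classes\<close>

lemma v_seq_cong: "[v = v'] (mod s) \<Longrightarrow> [v_seq v n = v_seq v' n] (mod s)"
  by (simp add: v_seq_def)

lemma a_seq_cong:
  assumes "[v = v'] (mod s)" "[m = m'] (mod s)"
  shows "[a_seq eps v m n = a_seq eps v' m' n] (mod s)"
proof (induction n rule: induct_nat_012)
  case (ge2 n)
  then show ?case
    unfolding a_seq.simps by (intro cong_add cong_mult v_seq_cong assms cong_refl)
qed simp_all

lemma s_seq_cong:
  assumes "[v = v'] (mod s)" "[m = m'] (mod s)"
  shows "s_seq s eps v m n = s_seq s eps v' m' n"
  unfolding s_seq_def by (rule cong_gcd_eq[OF a_seq_cong[OF assms]])

lemma cong_div_div: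
  fixes a b d s :: int
  assumes "[a = b] (mod s)" "d dvd a" "d dvd b" "d dvd s" "d \<noteq> 0"
  shows "[a div d = b div d] (mod (s div d))"
  using assms by (auto simp: cong_iff_dvd_diff elim!: dvdE simp flip: right_diff_distrib)

lemma m_seq_cong:
  assumes "s > 0" "[v = v'] (mod s)" "[m = m'] (mod s)"
  shows "m_seq s eps v m n = m_seq s eps v' m' n"
proof -
  let ?g = "s_seq s eps v' m' n"
  let ?M = "s div ?g"
  have g: "s_seq s eps v m n = ?g" by (rule s_seq_cong[OF assms(2,3)])
  have dvd: "?g dvd a_seq eps v m n" "?g dvd a_seq eps v' m' n" "?g dvd s"
    using g by (metis s_seq_def gcd_dvd1, simp_all add: s_seq_def)
  have "?g \<noteq> 0" using assms(1) by (simp add: s_seq_def)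
  then have 1: "[a_seq eps v m n div ?g = a_seq eps v' m' n div ?g] (mod ?M)"
    by (intro cong_div_div a_seq_cong assms dvd)
  \<comment> \<open>The preceding terms agree modulo \<open>s\<close>; the defining congruence lives
    modulo the divisor \<open>?M\<close>.\<close>
  have "?M dvd s" using dvd(3) by (metis dvd_div_mult_self dvd_triv_left)
  then have 2: "[- a_seq eps v m (n - 1) = - a_seq eps v' m' (n - 1)] (mod ?M)"
    using cong_dvd_modulus[OF a_seq_cong[OF assms(2,3)]] by (simp add: cong_minus_minus_iff)
  \<comment> \<open>The two definite descriptions have equivalent predicates, hence equal
    values.\<close>
  have "[k * (a_seq eps v m n div ?g) = - a_seq eps v m (n - 1)] (mod ?M) \<longleftrightarrow>
      [k * (a_seq eps v' m' n div ?g) = - a_seq eps v' m' (n - 1)] (mod ?M)" for k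
    using cong_scalar_left[OF 1, of k] 2 by (meson cong_sym cong_trans)
  then show ?thesis unfolding m_seq_def g by simp
qed

text \<open>The change is recorded in two forms: as an integer \<open>k\<close>, which can be
  absorbed by the head of an expansion, and as a fixed multiple of \<open>d\<close>, which yields
  the slope of the affine law.\<close>

lemma xi_hat_shift:
  fixes s eps v v' m m' :: int and n :: nat
  assumes "s > 0" "[v = v'] (mod s)" "[m = m'] (mod s)"
  defines "d \<equiv> v_seq v n * m - v_seq v' n * m'" and "g \<equiv> s_seq s eps v' m' n"
  obtains k where "xi_hat s eps v m n = xi_hat s eps v' m' n + of_int k"
    and "(of_int k :: rat) = of_int (g\<^sup>2) / of_int s * of_int d"
proof -
  have "[v_seq v n * m = v_seq v' n * m'] (mod s)"
    by (intro cong_mult v_seq_cong assms)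
  then obtain e where e: "d = s * e"
    by (auto simp: d_def cong_iff_dvd_diff elim!: dvdE)
  have "g dvd s" "g \<noteq> 0" using assms(1) by (auto simp: g_def s_seq_def)
  then have div: "(of_int (s div g) :: rat) = of_int s / of_int g"
    by (simp add: of_int_div)
  have "xi_hat s eps v m n - xi_hat s eps v' m' n = of_int (g * d) / of_int (s div g)"
    unfolding xi_hat_def s_seq_cong[OF assms(2,3)] m_seq_cong[OF assms(1-3)]
    by (simp add: g_def d_def algebra_simps flip: diff_divide_distrib)
  also have "\<dots> = of_int (g\<^sup>2) / of_int s * of_int d"
    unfolding div by (simp add: power2_eq_square)
  also have "\<dots> = of_int (g\<^sup>2 * e)" using assms(1) by (simp add: e)
  finally show ?thesis
    using e assms(1) by (intro that[of "g\<^sup>2 * e"]) (simp_all add: algebra_simps)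
qed

section \<open>Packets and integer shifts of their targets\<close>

definition packet_target :: "int \<Rightarrow> int \<Rightarrow> int \<Rightarrow> int \<Rightarrow> nat \<Rightarrow> rat" where
  "packet_target s eps v m n =
     (if n = 0 then xi_hat s eps v m 0 else xi_hat s eps v m n - of_int (delta eps))"

text \<open>Uniqueness for a given parity evaluates the definite description;
  \<open>eps \<noteq> 1\<close> encodes the prescribed even length.\<close>

lemma packet_eqI:
  assumes "cf_expansion cs (packet_target s eps v m n)" "even (length cs) \<longleftrightarrow> eps \<noteq> 1"
  shows "packet s eps v m n = cs"
  unfolding packet_def packet_target_def[symmetric]
  using assms by (intro the_equality) (auto intro: cf_expansion_unique split: if_splits)

lemma packet_expansion:
  "cf_expansion (packet s eps v m n) (packet_target s eps v m n)"
  "even (length (packet s eps v m n)) \<longleftrightarrow> eps \<noteq> 1"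
proof -
  obtain cs where cs: "cf_expansion cs (packet_target s eps v m n)"
      "even (length cs) \<longleftrightarrow> eps \<noteq> 1"
    using cf_expansion_exists by blast
  with packet_eqI[OF cs]
  show "cf_expansion (packet s eps v m n) (packet_target s eps v m n)"
    "even (length (packet s eps v m n)) \<longleftrightarrow> eps \<noteq> 1" by simp_all
qed

lemma packet_not_Nil: "packet s eps v m n \<noteq> []"
  using packet_expansion(1) by (simp add: cf_expansion_def)

lemma packet_shift:
  assumes "xi_hat s eps v m n = xi_hat s eps v' m' n + of_int k"
  shows "packet s eps v m n = (hd (packet s eps v' m' n) + k) # tl (packet s eps v' m' n)"
proof (rule packet_eqI)
  \<comment> \<open>The offset \<open>delta eps\<close> is the same on both sides and
    cancels.\<close>
  have "packet_target s eps v m n = packet_target s eps v' m' n + of_int k"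
    using assms by (auto simp: packet_target_def)
  then show "cf_expansion ((hd (packet s eps v' m' n) + k) # tl (packet s eps v' m' n))
      (packet_target s eps v m n)"
    using cf_expansion_shift[OF packet_expansion(1)] by metis
  show "even (length ((hd (packet s eps v' m' n) + k) # tl (packet s eps v' m' n))) \<longleftrightarrow> eps \<noteq> 1"
    using packet_expansion(2)[of s eps v' m' n] packet_not_Nil[of s eps v' m' n]
    by (cases "packet s eps v' m' n") auto
qed

theorem theorem5p1:
  fixes s eps v0 m0 :: int and n :: nat
  assumes "s > 0" and "eps \<in> {1, -1}"
  shows "\<exists>(L :: nat) (t :: nat \<Rightarrow> int) (\<alpha> :: rat) (\<beta> :: rat). L \<ge> 1 \<and> \<alpha> \<noteq> 0 \<and>
    (\<forall>(v :: int) (m :: int). v > 0 \<and> m > 0 \<and> [v = v0] (mod s) \<and> [m = m0] (mod s) \<and>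
        \<not> (eps = -1 \<and> v * m\<^sup>2 \<le> 4) \<longrightarrow>
      length (packet s eps v m n) = L \<and>
      (\<forall>i. 1 \<le> i \<and> i < L \<longrightarrow> packet s eps v m n ! i = t i) \<and>
      of_int (packet s eps v m n ! 0) = \<alpha> * of_int (if odd n then m else v * m) + \<beta>)"
proof -
  \<comment> \<open>The packet at the class representatives themselves is the reference; all others
    in the class are shifts of it and share the tail \<open>T\<close>.\<close>
  obtain h T where P: "packet s eps v0 m0 n = h # T"
    using packet_not_Nil by (meson neq_Nil_conv)
  define g where "g = s_seq s eps v0 m0 n"
  \<comment> \<open>The slope is the factor from \<open>xi_hat_shift\<close>; \<open>\<beta>\<close>
    is chosen so that the affine law gives \<open>h\<close> at the reference pair.\<close>
  define \<alpha> :: rat where "\<alpha> = of_int (g\<^sup>2) / of_int s"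
  define \<beta> :: rat where "\<beta> = of_int h - \<alpha> * of_int (v_seq v0 n * m0)"
  have "g \<noteq> 0" using assms(1) by (simp add: g_def s_seq_def)
  then have \<alpha>: "\<alpha> \<noteq> 0" using assms(1) by (simp add: \<alpha>_def)
  have "length (packet s eps v m n) = Suc (length T) \<and>
      (\<forall>i. 1 \<le> i \<and> i < Suc (length T) \<longrightarrow> packet s eps v m n ! i = (h # T) ! i) \<and>
      of_int (packet s eps v m n ! 0) = \<alpha> * of_int (if odd n then m else v * m) + \<beta>"
    if vm: "[v = v0] (mod s)" "[m = m0] (mod s)" for v m
  proof -
    obtain k where k: "xi_hat s eps v m n = xi_hat s eps v0 m0 n + of_int k"
        "(of_int k :: rat) = \<alpha> * of_int (v_seq v n * m - v_seq v0 n * m0)"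
      using xi_hat_shift[OF assms(1) vm, of eps n] unfolding \<alpha>_def g_def by blast
    have "packet s eps v m n = (h + k) # T" using packet_shift[OF k(1)] P by simp
    moreover have "(of_int (h + k) :: rat) = \<alpha> * of_int (v_seq v n * m) + \<beta>"
      using k(2) by (simp add: \<beta>_def algebra_simps)
    moreover have "v_seq v n * m = (if odd n then m else v * m)" by (simp add: v_seq_def)
    ultimately show ?thesis by (auto simp: nth_Cons')
  qed
  then show ?thesis
    using \<alpha> by (intro exI[of _ "Suc (length T)"] exI[of _ "\<lambda>i. (h # T) ! i"] exI[of _ \<alpha>] exI[of _ \<beta>]) auto
qed

end
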